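(* Let $k,r$ be positive integers with $r\le k$. Then for every integer $h\ge\max\{r,2\}$ and every non-empty $k$-element set $A$ of integers, \[ |h^{(\geq r)}A| \ge h(k-1)-r(r-1)+1. \] Furthermore, suppose $|h^{(\geq r)}A| = h(k-1)-r(r-1)+1$ and that either (1) $h\ge r+2$ and $k\ge 2$, or (2) $h=r$ or $h=r+1$, and $k\ge 5$ and $2\le r\le k-2$. Then $A$ is an arithmetic progression.
   Context: For a finite non-empty set $A=\{a_1,\ldots,a_k\}$ of integers, a positive integer $r\le k$ and an integer $h\ge r$, define $h^{(\geq r)}A := \{ \sum_{i\in I} x_i a_i : I\subset\{1,\ldots,k\},\ |I|\ge r,\ x_i\ge 1 \text{ for all } i\in I,\ \sum_{i\in I}x_i = h\}$, i.e. the set of sums of $h$ elements of $A$ among which at least $r$ are distinct. *)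

theory Defs
  imports Complex_Main
begin

(* Since the elements a_1, ..., a_k of A are distinct, index sets I of {1, ..., k} are
   represented by the corresponding subsets B of A, and x_i is written x a for a = a_i. *)
definition sums_with_distinct :: "nat \<Rightarrow> nat \<Rightarrow> int set \<Rightarrow> int set" where
  "sums_with_distinct h r A =
     {\<Sum>a\<in>B. int (x a) * a | (B :: int set) (x :: int \<Rightarrow> nat).
        B \<subseteq> A \<and> card B \<ge> r \<and> (\<forall>a\<in>B. x a \<ge> 1) \<and> (\<Sum>a\<in>B. x a) = h}"

definition arith_progression :: "int set \<Rightarrow> bool" where
  "arith_progression A \<longleftrightarrow>
     (\<exists>(a :: int) (d :: int) (n :: nat). d > 0 \<and> A = {a + int i * d | i. i < n})"

end

(* Write A = {a 0 < ... < a (k - 1)}. A sum of h elements of A, at least r of them distinct, is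
   given by an r-subset S of {..<k} together with a multiset M of h - r further indices. Grade
   these pairs by the total of their indices. Moving a single index by one changes the grade by one
   and the sum strictly in the same direction, so every pair of grade n has at least n - lo sums
   below it and hi - n sums above it, where lo and hi are the extreme grades. This gives the bound
   hi - lo + 1, and in the case of equality a sum depends only on its grade. Comparing pairs of
   equal grade then shows that consecutive differences of a coincide. *)

theory Submission
  imports Defs "HOL-Library.Multiset"
begin

section \<open>Counting the values of a graded set\<close>

text \<open>Descend from \<open>t\<close> one rank at a time until \<open>lo\<close> is reached:
  each step adds a new value, since \<open>val t'\<close> is below \<open>val t\<close> but not
  below itself.\<close>

lemma graded_values_below:
  fixes rank :: "'s \<Rightarrow> nat" and val :: "'s \<Rightarrow> 'v::linorder"
  assumes fin: "finite (val ` T)"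
    and down: "\<And>t. t \<in> T \<Longrightarrow> lo < rank t \<Longrightarrow> \<exists>t'\<in>T. rank t = Suc (rank t') \<and> val t' < val t"
    and "t \<in> T"
  shows "rank t \<le> lo + card {v \<in> val ` T. v < val t}"
  using \<open>t \<in> T\<close>
proof (induction "rank t" arbitrary: t)
  case 0
  then show ?case by simp
next
  case (Suc n)
  show ?case
  proof (cases "lo < rank t")
    case True
    then obtain t' where t': "t' \<in> T" "rank t = Suc (rank t')" "val t' < val t"
      using down Suc.prems by blast
    have "Suc (card {v \<in> val ` T. v < val t'}) = card (insert (val t') {v \<in> val ` T. v < val t'})"
      using fin by simp
    also have "\<dots> \<le> card {v \<in> val ` T. v < val t}"
      by (rule card_mono) (use fin t' in auto)
    finally show ?thesis using Suc.hyps t' by fastforce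
  qed simp
qed

text \<open>The mirror image, ascending to \<open>hi\<close>. The induction runs on the truncated
  difference \<open>hi - rank t\<close>, so its base case covers every rank from \<open>hi\<close>
  on.\<close>

lemma graded_values_above:
  fixes rank :: "'s \<Rightarrow> nat" and val :: "'s \<Rightarrow> 'v::linorder"
  assumes fin: "finite (val ` T)"
    and up: "\<And>t. t \<in> T \<Longrightarrow> rank t < hi \<Longrightarrow> \<exists>t'\<in>T. rank t' = Suc (rank t) \<and> val t < val t'"
    and "t \<in> T"
  shows "hi \<le> rank t + card {v \<in> val ` T. val t < v}"
  using \<open>t \<in> T\<close>
proof (induction "hi - rank t" arbitrary: t)
  case 0
  then show ?case by simp
next
  case (Suc n)
  then obtain t' where t': "t' \<in> T" "rank t' = Suc (rank t)" "val t < val t'"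
    using up[of t] by fastforce
  have "Suc (card {v \<in> val ` T. val t' < v}) = card (insert (val t') {v \<in> val ` T. val t' < v})"
    using fin by simp
  also have "\<dots> \<le> card {v \<in> val ` T. val t < v}"
    by (rule card_mono) (use fin t' in auto)
  finally show ?case using Suc.hyps(1)[of t'] Suc.hyps(2) t' by fastforce
qed

text \<open>Any \<open>t\<close> splits the values into those below, \<open>val t\<close> itself and
  those above, and the two one-sided counts add up to at least \<open>hi - lo\<close>. If the total
  is as small as possible, both counts are exact: \<open>rank t\<close> determines how many values
  lie below \<open>val t\<close>, and this number determines \<open>val t\<close>.\<close>

lemma card_graded_values:
  fixes rank :: "'s \<Rightarrow> nat" and val :: "'s \<Rightarrow> 'v::linorder"
  assumes fin: "finite (val ` T)" and "T \<noteq> {}"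
    and down: "\<And>t. t \<in> T \<Longrightarrow> lo < rank t \<Longrightarrow> \<exists>t'\<in>T. rank t = Suc (rank t') \<and> val t' < val t"
    and up: "\<And>t. t \<in> T \<Longrightarrow> rank t < hi \<Longrightarrow> \<exists>t'\<in>T. rank t' = Suc (rank t) \<and> val t < val t'"
  shows "hi + 1 \<le> lo + card (val ` T)"
    and "\<lbrakk>hi + 1 = lo + card (val ` T); s \<in> T; t \<in> T; rank s = rank t\<rbrakk> \<Longrightarrow> val s = val t"
proof -
  let ?below = "\<lambda>t. {v \<in> val ` T. v < val t}" and ?above = "\<lambda>t. {v \<in> val ` T. val t < v}"
  have below: "rank t \<le> lo + card (?below t)" if "t \<in> T" for t
    by (rule graded_values_below[OF fin down that])
  have above: "hi \<le> rank t + card (?above t)" if "t \<in> T" for t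
    by (rule graded_values_above[OF fin up that])
  have split: "card (val ` T) = card (?below t) + 1 + card (?above t)" if "t \<in> T" for t
  proof -
    have "val ` T = insert (val t) (?below t \<union> ?above t)"
      using that by auto
    also have "card \<dots> = Suc (card (?below t \<union> ?above t))"
      using fin by (subst card_insert_disjoint) auto
    also have "card (?below t \<union> ?above t) = card (?below t) + card (?above t)"
      using fin by (intro card_Un_disjoint) auto
    finally show ?thesis by simp
  qed
  show "hi + 1 \<le> lo + card (val ` T)"
    using \<open>T \<noteq> {}\<close> below above split by fastforce
  assume eq: "hi + 1 = lo + card (val ` T)" and st: "s \<in> T" "t \<in> T" "rank s = rank t"
  have eq_below: "card (?below s) = card (?below t)"
    using eq st below[of s] below[of t] above[of s] above[of t] split[of s] split[of t] by linarith
  \<comment> \<open>\<open>val u\<close> is below \<open>val v\<close> but not below itself, so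
    distinct values have different numbers of values below them.\<close>
  have less: "card (?below u) < card (?below v)" if "u \<in> T" "val u < val v" for u v
    by (rule psubset_card_mono) (use fin that in auto)
  show "val s = val t"
    using eq_below less[of s t] less[of t s] st by fastforce
qed

section \<open>Index sets that admit no further move\<close>

lemma down_closed_nat_eq_lessThan:
  fixes S :: "nat set"
  assumes "finite S" and "\<And>i. Suc i \<in> S \<Longrightarrow> i \<in> S"
  shows "S = {..<card S}"
proof -
  have closed: "{..x} \<subseteq> S" if "x \<in> S" for x
    using that by (induction x) (use assms(2) in \<open>auto simp: atMost_Suc\<close>)
  have "x < card S" if "x \<in> S" for x
    using card_mono[OF assms(1) closed[OF that]] by simp
  then show ?thesis
    by (intro card_subset_eq) auto
qed

text \<open>An element \<open>x\<close> forces all of \<open>{x..<k}\<close> into \<open>S\<close>,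
  whence \<open>k - card S\<close> is at most \<open>x\<close>; comparing cardinalities then gives
  equality.\<close>

lemma up_closed_nat_eq_atLeastLessThan:
  fixes S :: "nat set"
  assumes "S \<subseteq> {..<k}" and up: "\<And>i. i \<in> S \<Longrightarrow> Suc i < k \<Longrightarrow> Suc i \<in> S"
  shows "S = {k - card S..<k}"
proof -
  have fin: "finite S" using assms(1) finite_subset by blast
  have closed: "{x..<k} \<subseteq> S" if "x \<in> S" for x
  proof
    fix y assume "y \<in> {x..<k}"
    then have "x \<le> y" "y < k" by auto
    then show "y \<in> S"
      by (induction y rule: dec_induct) (use that up in auto)
  qed
  have "k - card S \<le> x" if "x \<in> S" for x
    using card_mono[OF fin closed[OF that]] by simp
  moreover have "card S \<le> k"
    using card_mono[OF _ assms(1)] by simp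
  ultimately show ?thesis
    using assms(1) by (intro card_subset_eq) auto
qed

lemma sum_top_interval:
  fixes r k :: nat
  assumes "r \<le> k"
  shows "\<Sum>{k - r..<k} = \<Sum>{..<r} + r * (k - r)"
proof -
  have "\<Sum>{k - r..<k} = (\<Sum>i<r. i + (k - r))"
    by (rule sum.reindex_bij_witness[of _ "\<lambda>i. i + (k - r)" "\<lambda>i. i - (k - r)"]) (use assms in auto)
  then show ?thesis by (simp add: sum.distrib)
qed

section \<open>Index pairs and unit moves\<close>

text \<open>\<open>S\<close> alone guarantees the \<open>r\<close> distinct summands, and
  \<open>M\<close> may repeat its indices. Hence a move inside \<open>M\<close> never has to avoid a
  collision.\<close>

definition index_pairs :: "nat \<Rightarrow> nat \<Rightarrow> nat \<Rightarrow> (nat set \<times> nat multiset) set" where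
  "index_pairs k r m =
     {(S, M). S \<subseteq> {..<k} \<and> card S = r \<and> set_mset M \<subseteq> {..<k} \<and> size M = m}"

text \<open>Generic in \<open>f\<close>, so that \<open>f = id\<close> gives the grade of a pair and
  \<open>f = a\<close> the sum it represents; one replacement lemma then serves both.\<close>

definition pair_sum :: "(nat \<Rightarrow> 'a::comm_monoid_add) \<Rightarrow> nat set \<times> nat multiset \<Rightarrow> 'a" where
  "pair_sum f t = sum f (fst t) + (\<Sum>i\<in>#snd t. f i)"

text \<open>Written with a summand added on each side instead of a subtraction, so that it applies
  to grades in \<open>nat\<close> as well as to sums in \<open>int\<close>.\<close>

lemma sum_replace:
  fixes f :: "nat \<Rightarrow> 'a::comm_monoid_add"
  assumes "finite S" "i \<in> S" "j \<notin> S"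
  shows "sum f (insert j (S - {i})) + f i = sum f S + f j"
proof -
  have insert: "sum f (insert j (S - {i})) = f j + sum f (S - {i})"
    using assms by (subst sum.insert) auto
  have remove: "sum f S = f i + sum f (S - {i})"
    using assms by (simp only: sum.remove)
  show ?thesis unfolding insert remove by (simp only: ac_simps)
qed

lemma index_pairs_replace_fst:
  assumes t: "(S, M) \<in> index_pairs k r m" and "i \<in> S" "j \<notin> S" "j < k"
  shows "(insert j (S - {i}), M) \<in> index_pairs k r m"
    and "pair_sum f (insert j (S - {i}), M) + f i = pair_sum f (S, M) + f j"
proof -
  have fin: "finite S" using t finite_subset by (auto simp: index_pairs_def)
  then have "card (insert j (S - {i})) = card S"
    using assms card_gt_0_iff[of S] by (auto simp: card_Diff_singleton)
  then show "(insert j (S - {i}), M) \<in> index_pairs k r m"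
    using assms by (auto simp: index_pairs_def)
  show "pair_sum f (insert j (S - {i}), M) + f i = pair_sum f (S, M) + f j"
    using arg_cong[OF sum_replace[OF fin assms(2,3), of f], of "\<lambda>s. s + (\<Sum>i\<in>#M. f i)"]
    by (simp add: pair_sum_def ac_simps del: sum.insert)
qed

lemma index_pairs_replace_snd:
  assumes t: "(S, M) \<in> index_pairs k r m" and "i \<in># M" "j < k"
  shows "(S, add_mset j (M - {#i#})) \<in> index_pairs k r m"
    and "pair_sum f (S, add_mset j (M - {#i#})) + f i = pair_sum f (S, M) + f j"
proof -
  obtain N where N: "M = add_mset i N" using \<open>i \<in># M\<close> by (metis insert_DiffM)
  show "(S, add_mset j (M - {#i#})) \<in> index_pairs k r m"
    using assms by (auto simp: index_pairs_def N)
  show "pair_sum f (S, add_mset j (M - {#i#})) + f i = pair_sum f (S, M) + f j"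
    by (simp add: pair_sum_def N ac_simps)
qed

text \<open>Some index of \<open>S\<close> or of \<open>M\<close> can be lowered by one unless
  \<open>S\<close> is down-closed and \<open>M\<close> consists of zeros. The only such pair has the
  grade excluded by the last assumption.\<close>

lemma index_pairs_step_down:
  fixes a :: "nat \<Rightarrow> int"
  assumes mono: "strict_mono_on {..<k} a" and t: "t \<in> index_pairs k r m"
    and rank: "\<Sum>{..<r} < pair_sum id t"
  shows "\<exists>t'\<in>index_pairs k r m. pair_sum id t = Suc (pair_sum id t') \<and> pair_sum a t' < pair_sum a t"
proof -
  obtain S M where SM: "t = (S, M)" by fastforce
  have S: "S \<subseteq> {..<k}" "card S = r" and M: "set_mset M \<subseteq> {..<k}"
    using t by (auto simp: SM index_pairs_def)
  have less: "a i < a (Suc i)" if "Suc i < k" for i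
    using mono that by (auto simp: strict_mono_on_def)
  consider i where "Suc i \<in> S" "i \<notin> S" | i where "Suc i \<in># M"
    | "\<And>i. Suc i \<in> S \<Longrightarrow> i \<in> S" "\<And>i. Suc i \<notin># M" by blast
  then show ?thesis
  proof cases
    case 1
    then have "Suc i < k" using S by auto
    then show ?thesis
      using index_pairs_replace_fst(1)[OF t[unfolded SM] 1]
        index_pairs_replace_fst(2)[OF t[unfolded SM] 1, where f = id]
        index_pairs_replace_fst(2)[OF t[unfolded SM] 1, where f = a] less[of i]
      by (intro bexI[of _ "(insert i (S - {Suc i}), M)"]) (auto simp: SM)
  next
    case 2
    then have "Suc i < k" using M by auto
    then show ?thesis
      using index_pairs_replace_snd(1)[OF t[unfolded SM] 2, where j = i]
        index_pairs_replace_snd(2)[OF t[unfolded SM] 2, where j = i and f = id]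
        index_pairs_replace_snd(2)[OF t[unfolded SM] 2, where j = i and f = a] less[of i]
      by (intro bexI[of _ "(S, add_mset i (M - {#Suc i#}))"]) (auto simp: SM)
  next
    case 3
    have "S = {..<r}"
      using down_closed_nat_eq_lessThan[of S] 3 S finite_subset[of S "{..<k}"] by auto
    moreover have "i = 0" if "i \<in># M" for i
      using 3(2) that by (cases i) auto
    ultimately have "pair_sum id t = \<Sum>{..<r}" by (simp add: SM pair_sum_def)
    with rank show ?thesis by simp
  qed
qed

text \<open>The mirror image: the only pair without an upward move has \<open>S\<close> equal to the
  top interval and every entry of \<open>M\<close> equal to \<open>k - 1\<close>.\<close>

lemma index_pairs_step_up:
  fixes a :: "nat \<Rightarrow> int"
  assumes mono: "strict_mono_on {..<k} a" and t: "t \<in> index_pairs k r m"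
    and rank: "pair_sum id t < \<Sum>{k - r..<k} + m * (k - 1)"
  shows "\<exists>t'\<in>index_pairs k r m. pair_sum id t' = Suc (pair_sum id t) \<and> pair_sum a t < pair_sum a t'"
proof -
  obtain S M where SM: "t = (S, M)" by fastforce
  have S: "S \<subseteq> {..<k}" "card S = r" and M: "set_mset M \<subseteq> {..<k}" "size M = m"
    using t by (auto simp: SM index_pairs_def)
  have less: "a i < a (Suc i)" if "Suc i < k" for i
    using mono that by (auto simp: strict_mono_on_def)
  consider i where "i \<in> S" "Suc i \<notin> S" "Suc i < k" | i where "i \<in># M" "Suc i < k"
    | "\<And>i. i \<in> S \<Longrightarrow> Suc i < k \<Longrightarrow> Suc i \<in> S" "\<And>i. i \<in># M \<Longrightarrow> \<not> Suc i < k" by blast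
  then show ?thesis
  proof cases
    case 1
    then show ?thesis
      using index_pairs_replace_fst(1)[OF t[unfolded SM] 1]
        index_pairs_replace_fst(2)[OF t[unfolded SM] 1, where f = id]
        index_pairs_replace_fst(2)[OF t[unfolded SM] 1, where f = a] less[of i]
      by (intro bexI[of _ "(insert (Suc i) (S - {i}), M)"]) (auto simp: SM)
  next
    case 2
    then show ?thesis
      using index_pairs_replace_snd(1)[OF t[unfolded SM] 2]
        index_pairs_replace_snd(2)[OF t[unfolded SM] 2, where f = id]
        index_pairs_replace_snd(2)[OF t[unfolded SM] 2, where f = a] less[of i]
      by (intro bexI[of _ "(S, add_mset (Suc i) (M - {#i#}))"]) (auto simp: SM)
  next
    case 3
    have "S = {k - r..<k}"
      using up_closed_nat_eq_atLeastLessThan[of S k] 3 S by auto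
    moreover have "i = k - 1" if "i \<in># M" for i
    proof -
      have "i < k" using M that by auto
      with 3(2)[OF that] show ?thesis by simp
    qed
    then have "M = replicate_mset m (k - 1)"
      using M(2) set_mset_subset_singletonD[of M "k - 1"] by auto
    ultimately show ?thesis using rank by (simp add: SM pair_sum_def)
  qed
qed

section \<open>From index pairs to sums of elements of the set\<close>

text \<open>Each coefficient is at most \<open>h\<close>, which bounds every sum in absolute value.
  Finiteness is what allows cardinalities of subsets to be compared later.\<close>

lemma finite_sums_with_distinct:
  assumes "finite A"
  shows "finite (sums_with_distinct h r A)"
proof -
  let ?C = "int h * (\<Sum>a\<in>A. \<bar>a\<bar>)"
  have "\<bar>\<Sum>b\<in>B. int (x b) * b\<bar> \<le> ?C" if "B \<subseteq> A" "(\<Sum>b\<in>B. x b) = h" for B and x :: "int \<Rightarrow> nat"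
  proof -
    have fin: "finite B" using that assms finite_subset by blast
    have "\<bar>\<Sum>b\<in>B. int (x b) * b\<bar> \<le> (\<Sum>b\<in>B. \<bar>int (x b) * b\<bar>)" by (rule sum_abs)
    also have "\<dots> \<le> (\<Sum>b\<in>B. int h * \<bar>b\<bar>)"
    proof (rule sum_mono)
      fix b assume "b \<in> B"
      then have "x b \<le> h" using that(2) fin member_le_sum[of b B x] by auto
      then show "\<bar>int (x b) * b\<bar> \<le> int h * \<bar>b\<bar>"
        by (simp add: abs_mult mult_right_mono)
    qed
    also have "\<dots> \<le> (\<Sum>b\<in>A. int h * \<bar>b\<bar>)"
      using that assms by (intro sum_mono2) auto
    finally show ?thesis by (simp add: sum_distrib_left)
  qed
  then have "sums_with_distinct h r A \<subseteq> {-?C..?C}"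
    by (fastforce simp: sums_with_distinct_def abs_le_iff)
  then show ?thesis by (rule finite_subset) simp
qed

lemma sum_mset_multiplicity:
  fixes M :: "'a::semiring_1 multiset"
  shows "sum_mset M = (\<Sum>x\<in>set_mset M. of_nat (count M x) * x)"
proof (induction M)
  case (add y M)
  have "(\<Sum>x\<in>set_mset (add_mset y M). of_nat (count (add_mset y M) x) * x)
      = (\<Sum>x\<in>insert y (set_mset M). of_nat (count M x) * x + (if x = y then x else 0))"
    by (auto intro!: sum.cong simp: algebra_simps)
  also have "\<dots> = (\<Sum>x\<in>insert y (set_mset M). of_nat (count M x) * x) + y"
    by (simp add: sum.distrib)
  also have "(\<Sum>x\<in>insert y (set_mset M). of_nat (count M x) * x) = (\<Sum>x\<in>set_mset M. of_nat (count M x) * x)"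
    by (rule sum.mono_neutral_right) (auto simp: not_in_iff)
  finally show ?case using add.IH by (simp add: add.commute)
qed simp

text \<open>Merge \<open>S\<close> and \<open>M\<close> into one multiset \<open>W\<close> of
  elements of \<open>A\<close>: its support serves as \<open>B\<close> and its multiplicities as
  \<open>x\<close>. The support contains the \<open>r\<close> distinct images of
  \<open>S\<close>.\<close>

lemma pair_sum_in_sums_with_distinct:
  fixes a :: "nat \<Rightarrow> int"
  assumes bij: "bij_betw a {..<k} A" and t: "t \<in> index_pairs k r m"
  shows "pair_sum a t \<in> sums_with_distinct (r + m) r A"
proof -
  obtain S M where SM: "t = (S, M)" by fastforce
  have S: "S \<subseteq> {..<k}" "card S = r" and M: "set_mset M \<subseteq> {..<k}" "size M = m"
    using t by (auto simp: SM index_pairs_def)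
  have fin: "finite S" using S finite_subset by blast
  define W where "W = image_mset a (mset_set S + M)"
  have "card (a ` S) = r"
    using bij S by (metis bij_betw_def card_image inj_on_subset)
  moreover have "a ` S \<subseteq> set_mset W" using fin by (auto simp: W_def)
  ultimately have "r \<le> card (set_mset W)"
    by (metis card_mono finite_set_mset)
  moreover have "set_mset W \<subseteq> A"
    using bij S M fin by (auto simp: W_def bij_betw_def)
  moreover have "size W = r + m"
    using S M by (simp add: W_def)
  then have "(\<Sum>b\<in>set_mset W. count W b) = r + m"
    by (simp only: size_multiset_overloaded_eq)
  moreover have "pair_sum a t = sum_mset W"
    by (simp add: W_def SM pair_sum_def sum_unfold_sum_mset)
  then have "pair_sum a t = (\<Sum>b\<in>set_mset W. int (count W b) * b)"
    by (simp only: sum_mset_multiplicity)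
  ultimately show ?thesis
    unfolding sums_with_distinct_def by (auto intro!: exI[of _ "set_mset W"] exI[of _ "count W"])
qed

section \<open>Progressions and enumerations\<close>

lemma arith_progression_if_differences_eq:
  fixes a :: "nat \<Rightarrow> int"
  assumes mono: "strict_mono_on {..<k} a" and "2 \<le> k"
    and diff: "\<And>i. Suc i < k \<Longrightarrow> a (Suc i) - a i = a 1 - a 0"
  shows "arith_progression (a ` {..<k})"
proof -
  have formula: "a i = a 0 + int i * (a 1 - a 0)" if "i < k" for i
    using that
  proof (induction i)
    case (Suc i)
    then show ?case using diff[of i] by (simp add: algebra_simps)
  qed simp
  have "a ` {..<k} = (\<lambda>i. a 0 + int i * (a 1 - a 0)) ` {..<k}"
    by (intro image_cong refl formula) simp
  then have "a ` {..<k} = {a 0 + int i * (a 1 - a 0) | i. i < k}"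
    by (simp only: setcompr_eq_image lessThan_def)
  moreover have "a 1 - a 0 > 0"
    using mono \<open>2 \<le> k\<close> by (auto simp: strict_mono_on_def)
  ultimately show ?thesis
    unfolding arith_progression_def by blast
qed

lemma obtain_strict_mono_enumeration:
  fixes A :: "'a::linorder set"
  assumes "finite A"
  obtains a :: "nat \<Rightarrow> 'a" where "strict_mono_on {..<card A} a" "bij_betw a {..<card A} A"
proof
  let ?a = "\<lambda>i. sorted_list_of_set A ! i"
  show mono: "strict_mono_on {..<card A} ?a"
    using sorted_wrt_nth_less[OF strict_sorted_list_of_set[of A]] by (auto simp: strict_mono_on_def)
  show "bij_betw ?a {..<card A} A"
    using assms by (intro bij_betw_nth) auto
qed

section \<open>The bound and the case of equality\<close>

theorem theorem3p5:
  fixes k r h :: nat and A :: "int set"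
  assumes "k \<ge> 1" and "r \<ge> 1" and "r \<le> k"
    and "h \<ge> max r 2"
    and "finite A" and "A \<noteq> {}" and "card A = k"
  shows "int (card (sums_with_distinct h r A)) \<ge> int h * (int k - 1) - int r * (int r - 1) + 1
    \<and> (int (card (sums_with_distinct h r A)) = int h * (int k - 1) - int r * (int r - 1) + 1
        \<and> ((h \<ge> r + 2 \<and> k \<ge> 2)
           \<or> ((h = r \<or> h = r + 1) \<and> k \<ge> 5 \<and> 2 \<le> r \<and> int r \<le> int k - 2))
       \<longrightarrow> arith_progression A)"
proof -
  obtain a :: "nat \<Rightarrow> int" where mono: "strict_mono_on {..<k} a" and bij: "bij_betw a {..<k} A"
    using obtain_strict_mono_enumeration[OF \<open>finite A\<close>] \<open>card A = k\<close> by metis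
  define m where "m = h - r"
  have h: "h = r + m" using \<open>h \<ge> max r 2\<close> by (simp add: m_def)
  let ?T = "index_pairs k r m" and ?X = "sums_with_distinct h r A"
  let ?lo = "\<Sum>{..<r}" and ?hi = "\<Sum>{k - r..<k} + m * (k - 1)"
  have sub: "pair_sum a ` ?T \<subseteq> ?X"
    using pair_sum_in_sums_with_distinct[OF bij] by (auto simp: h)
  have finX: "finite ?X" by (rule finite_sums_with_distinct[OF \<open>finite A\<close>])
  then have fin: "finite (pair_sum a ` ?T)" using sub finite_subset by blast
  have "({..<r}, replicate_mset m 0) \<in> ?T"
    using assms by (auto simp: index_pairs_def)
  then have ne: "?T \<noteq> {}" by auto
  note graded = card_graded_values[where rank = "pair_sum id",
      OF fin ne index_pairs_step_down[OF mono] index_pairs_step_up[OF mono]]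
  \<comment> \<open>The extreme grades differ by \<open>r * (k - r) + m * (k - 1)\<close>;
    substituting \<open>m = h - r\<close> turns this into
    \<open>h * (k - 1) - r * (r - 1)\<close>.\<close>
  have hi: "int ?hi + 1 = int ?lo + (int h * (int k - 1) - int r * (int r - 1) + 1)"
  proof -
    have "int ?hi = int ?lo + int r * int (k - r) + int m * int (k - 1)"
      by (simp only: sum_top_interval[OF \<open>r \<le> k\<close>] of_nat_add of_nat_mult)
    moreover have "int (k - r) = int k - int r" "int (k - 1) = int k - 1" "int h = int r + int m"
      using \<open>r \<le> k\<close> \<open>k \<ge> 1\<close> h by auto
    ultimately show ?thesis by (simp only:) (simp add: algebra_simps del: of_nat_sum)
  qed
  have le: "card (pair_sum a ` ?T) \<le> card ?X" by (rule card_mono[OF finX sub])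
  have bound: "?hi + 1 \<le> ?lo + card (pair_sum a ` ?T)" by (rule graded(1))
  have "arith_progression A"
    if eq: "int (card ?X) = int h * (int k - 1) - int r * (int r - 1) + 1"
      and cases: "(h \<ge> r + 2 \<and> k \<ge> 2)
           \<or> ((h = r \<or> h = r + 1) \<and> k \<ge> 5 \<and> 2 \<le> r \<and> int r \<le> int k - 2)"
  proof -
    \<comment> \<open>The pair sums lie in \<open>?X\<close> and already number at least
      \<open>?hi + 1 - ?lo\<close>, so equality for \<open>?X\<close> forces equality for
      them.\<close>
    have "?hi + 1 = ?lo + card (pair_sum a ` ?T)"
      using eq le bound hi by linarith
    then have val_eq: "pair_sum a s = pair_sum a t"
      if "s \<in> ?T" "t \<in> ?T" "pair_sum id s = pair_sum id t" for s t
      using graded(2) that by blast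
    have "a (Suc i) - a i = a 1 - a 0" if "Suc i < k" for i
      using cases
    proof
      assume "h \<ge> r + 2 \<and> k \<ge> 2"
      then obtain n where n: "m = n + 2" using h by (intro that[of "m - 2"]) auto
      \<comment> \<open>Two free slots in the multiset allow \<open>i\<close> and
        \<open>i + 2\<close> to be traded for \<open>i + 1\<close> twice without changing the
        grade.\<close>
      have step: "a (Suc (Suc i)) - a (Suc i) = a (Suc i) - a i" if "Suc (Suc i) < k" for i
      proof -
        have "pair_sum a ({..<r}, {#i, Suc (Suc i)#} + replicate_mset n 0)
            = pair_sum a ({..<r}, {#Suc i, Suc i#} + replicate_mset n 0)"
          by (rule val_eq) (use that n \<open>r \<le> k\<close> in \<open>auto simp: index_pairs_def pair_sum_def\<close>)
        then show ?thesis by (simp add: pair_sum_def)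
      qed
      show ?thesis using \<open>Suc i < k\<close>
        by (induction i) (use step in auto)
    next
      assume asm: "(h = r \<or> h = r + 1) \<and> k \<ge> 5 \<and> 2 \<le> r \<and> int r \<le> int k - 2"
      \<comment> \<open>Here \<open>m\<close> is 0 or 1, so the trade takes place inside
        \<open>S\<close>: \<open>i\<close> and \<open>j + 1\<close> become \<open>i + 1\<close> and
        \<open>j\<close>. The gap \<open>i + 2 \<le> j\<close> makes these four indices
        distinct.\<close>
      have far: "a (Suc i) - a i = a (Suc j) - a j" if "i + 2 \<le> j" "Suc j < k" for i j
      proof -
        let ?Q = "{i, Suc i, j, Suc j}"
        \<comment> \<open>A common filler \<open>R\<close> of \<open>r - 2\<close> indices avoiding
          all four must exist; this is where \<open>r \<le> k - 2\<close> enters.\<close>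
        have "card ({..<k} - ?Q) = k - 4"
          using that by (subst card_Diff_subset) auto
        then have "r - 2 \<le> card ({..<k} - ?Q)" using asm by linarith
        then obtain R where R: "R \<subseteq> {..<k} - ?Q" "card R = r - 2" "finite R"
          by (rule obtain_subset_with_card_n)
        have "pair_sum a (insert i (insert (Suc j) R), replicate_mset m 0)
            = pair_sum a (insert (Suc i) (insert j R), replicate_mset m 0)"
        proof (rule val_eq)
          have notin: "i \<notin> R" "Suc i \<notin> R" "j \<notin> R" "Suc j \<notin> R" using R by auto
          show "(insert i (insert (Suc j) R), replicate_mset m 0) \<in> ?T"
            "(insert (Suc i) (insert j R), replicate_mset m 0) \<in> ?T"
            using R that asm notin by (auto simp: index_pairs_def)
          show "pair_sum id (insert i (insert (Suc j) R), replicate_mset m 0)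
            = pair_sum id (insert (Suc i) (insert j R), replicate_mset m 0)"
            using R that notin by (simp add: pair_sum_def)
        qed
        moreover have "i \<notin> R" "Suc i \<notin> R" "j \<notin> R" "Suc j \<notin> R" using R by auto
        ultimately show ?thesis using R that by (simp add: pair_sum_def)
      qed
      \<comment> \<open>Differences 0 and 1 are too close to be compared directly; both are compared
        with difference 3, which exists because \<open>k \<ge> 5\<close>.\<close>
      consider "i = 0" | "i = 1" | "i \<ge> 2" by linarith
      then show ?thesis
      proof cases
        case 2
        then show ?thesis using far[of 1 3] far[of 0 3] asm by simp
      next
        case 3
        then show ?thesis using far[of 0 i] \<open>Suc i < k\<close> by simp
      qed simp
    qed
    moreover have "2 \<le> k" using cases by linarith
    ultimately have "arith_progression (a ` {..<k})"
      using arith_progression_if_differences_eq[OF mono] by blast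
    then show ?thesis using bij by (simp add: bij_betw_def)
  qed
  moreover have "int (card ?X) \<ge> int h * (int k - 1) - int r * (int r - 1) + 1"
    using bound le hi by linarith
  ultimately show ?thesis by blast
qed

end
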